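(* Let $(X_j,u_j)$, $j\in J$, be a (nonempty) family of ultrametric spaces with value sets $u_jX_j$. Then the ultrametric space $(\prod_{j\in J}X_j,u_{\rm prod})$ is spherically complete if and only if all $(X_j,u_j)$, $j\in J$, are spherically complete. If the index set $J$ is finite and all $u_jX_j$ are contained in some totally ordered set $\Gamma$ such that all of them have a common least element, then the same also holds for $u_{\rm max}$ in place of $u_{\rm prod}$.
   Context: An ultrametric $u$ on a nonempty set $X$ is a function from $X\times X$ to a partially ordered set $\Gamma$ with smallest element $0$ such that for all $x,y,z\in X$ and all $\gamma\in\Gamma$: (U1) $u(x,y)=0$ if and only if $x=y$; (U2) if $u(x,y)\leq\gamma$ and $u(y,z)\leq\gamma$, then $u(x,z)\leq\gamma$; (U3) $u(x,y)=u(y,x)$. The value set is $uX=\{u(x,y)\mid x,y\in X\}$; here each ultrametric is regarded as taking values in its value set, i.e. $\Gamma=uX$. For $x\in X$ and $\alpha\in uX$, the closed ultrametric ball is $B_\alpha(x)=\{y\in X\mid u(x,y)\leq\alpha\}$. $(X,u)$ is spherically complete if every nest (nonempty collection totally ordered by inclusion) of closed ultrametric balls has nonempty intersection. The product ultrametric on $\prod_{j\in J}X_j$ is $$u_{\rm prod}((a_j)_{j\in J},(b_j)_{j\in J})=(u_j(a_j,b_j))_{j\in J}\in\prod_{j\in J}u_jX_j,$$ where $\prod_{j\in J}u_jX_j$ carries the componentwise partial order. If $J$ is finite and all $u_jX_j$ are contained in a totally ordered set $\Gamma$ (with the induced order) with a common least element $0\in\Gamma$, then $$u_{\rm max}((a_j)_{j\in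 J},(b_j)_{j\in J})=\max_{j\in J}u_j(a_j,b_j)\in\bigcup_{j\in J}u_jX_j$$ defines an ultrametric on $\prod_{j\in J}X_j$. *)

theory Defs
  imports "HOL-Library.FuncSet"
begin

(* Partially ordered sets are pairs (G, r) with "partial_order_on G r"; "(a, b) \<in> r" means a \<le> b.
   Spaces and value sets are carrier sets, so that the members of a family may have different
   points and differently ordered value sets. *)

definition ultrametric_on ::
    "'a set \<Rightarrow> ('a \<Rightarrow> 'a \<Rightarrow> 'g) \<Rightarrow> 'g set \<Rightarrow> 'g rel \<Rightarrow> 'g \<Rightarrow> bool" where
  "ultrametric_on X u G r z \<longleftrightarrow>
     X \<noteq> {} \<and>
     partial_order_on G r \<and> z \<in> G \<and> (\<forall>\<gamma>\<in>G. (z, \<gamma>) \<in> r) \<and>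
     (\<forall>x\<in>X. \<forall>y\<in>X. u x y \<in> G) \<and>
     (\<forall>x\<in>X. \<forall>y\<in>X. u x y = z \<longleftrightarrow> x = y) \<and>
     (\<forall>x\<in>X. \<forall>y\<in>X. \<forall>w\<in>X. \<forall>\<gamma>\<in>G.
        (u x y, \<gamma>) \<in> r \<longrightarrow> (u y w, \<gamma>) \<in> r \<longrightarrow> (u x w, \<gamma>) \<in> r) \<and>
     (\<forall>x\<in>X. \<forall>y\<in>X. u x y = u y x)"

definition value_set :: "'a set \<Rightarrow> ('a \<Rightarrow> 'a \<Rightarrow> 'g) \<Rightarrow> 'g set" where
  "value_set X u = {u x y |x y. x \<in> X \<and> y \<in> X}"

definition uball :: "'a set \<Rightarrow> ('a \<Rightarrow> 'a \<Rightarrow> 'g) \<Rightarrow> 'g rel \<Rightarrow> 'g \<Rightarrow> 'a \<Rightarrow> 'a set" where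
  "uball X u r \<alpha> x = {y \<in> X. (u x y, \<alpha>) \<in> r}"

definition closed_uballs :: "'a set \<Rightarrow> ('a \<Rightarrow> 'a \<Rightarrow> 'g) \<Rightarrow> 'g rel \<Rightarrow> 'a set set" where
  "closed_uballs X u r = {uball X u r \<alpha> x |\<alpha> x. \<alpha> \<in> value_set X u \<and> x \<in> X}"

definition spherically_complete :: "'a set \<Rightarrow> ('a \<Rightarrow> 'a \<Rightarrow> 'g) \<Rightarrow> 'g rel \<Rightarrow> bool" where
  "spherically_complete X u r \<longleftrightarrow>
     (\<forall>N. N \<noteq> {} \<and> N \<subseteq> closed_uballs X u r \<and> chain\<^sub>\<subseteq> N \<longrightarrow> \<Inter>N \<noteq> {})"

definition u_prod ::
    "'j set \<Rightarrow> ('j \<Rightarrow> 'a \<Rightarrow> 'a \<Rightarrow> 'g) \<Rightarrow> ('j \<Rightarrow> 'a) \<Rightarrow> ('j \<Rightarrow> 'a) \<Rightarrow> ('j \<Rightarrow> 'g)" where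
  "u_prod J u a b = (\<lambda>j\<in>J. u j (a j) (b j))"

definition prod_order :: "'j set \<Rightarrow> ('j \<Rightarrow> 'g set) \<Rightarrow> ('j \<Rightarrow> 'g rel) \<Rightarrow> ('j \<Rightarrow> 'g) rel" where
  "prod_order J G r =
     {(f, g). f \<in> Pi\<^sub>E J G \<and> g \<in> Pi\<^sub>E J G \<and> (\<forall>j\<in>J. (f j, g j) \<in> r j)}"

(* "Max" is tied to class linorder, whereas the order here is a relation. *)
definition max_wrt :: "'g rel \<Rightarrow> 'g set \<Rightarrow> 'g" where
  "max_wrt R S = (THE m. m \<in> S \<and> (\<forall>s\<in>S. (s, m) \<in> R))"

definition u_max ::
    "'g rel \<Rightarrow> 'j set \<Rightarrow> ('j \<Rightarrow> 'a \<Rightarrow> 'a \<Rightarrow> 'g) \<Rightarrow> ('j \<Rightarrow> 'a) \<Rightarrow> ('j \<Rightarrow> 'a) \<Rightarrow> 'g" where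
  "u_max R J u a b = max_wrt R ((\<lambda>j. u j (a j) (b j)) ` J)"

lemma max_wrt:
  assumes lin: "linear_order_on G R" and "finite S" "S \<noteq> {}" "S \<subseteq> G"
  shows "max_wrt R S \<in> S" and "s \<in> S \<Longrightarrow> (s, max_wrt R S) \<in> R"
proof -
  have tr: "trans R" and as: "antisym R" and tot: "total_on G R"
    and re: "\<And>x. x \<in> G \<Longrightarrow> (x, x) \<in> R"
    using lin by (auto simp: order_on_defs refl_on_def)
  have "\<exists>m\<in>S. \<forall>s\<in>S. (s, m) \<in> R" using assms(2-4)
  proof (induction S rule: finite_ne_induct)
    case (singleton x) then show ?case using re by auto
  next
    case (insert x F)
    then obtain m where m: "m \<in> F" "\<forall>s\<in>F. (s, m) \<in> R" by auto
    have "x \<in> G" "m \<in> G" using insert.prems m by auto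
    then consider "(x, m) \<in> R" | "(m, x) \<in> R" using tot re unfolding total_on_def by metis
    then show ?case
    proof cases
      case 1 then show ?thesis using m by auto
    next
      case 2 then have "\<forall>s\<in>F. (s, x) \<in> R" using m tr by (meson transD)
      then show ?thesis using re \<open>x \<in> G\<close> by auto
    qed
  qed
  then have "\<exists>!m. m \<in> S \<and> (\<forall>s\<in>S. (s, m) \<in> R)" using as by (metis antisymD)
  then have "max_wrt R S \<in> S \<and> (\<forall>s\<in>S. (s, max_wrt R S) \<in> R)"
    unfolding max_wrt_def by (rule theI')
  then show "max_wrt R S \<in> S" "s \<in> S \<Longrightarrow> (s, max_wrt R S) \<in> R" by auto
qed

lemma value_set_u_prod:
  "value_set (Pi\<^sub>E J X) (u_prod J u) = Pi\<^sub>E J (\<lambda>j. value_set (X j) (u j))"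
proof (intro equalityI subsetI)
  fix f assume "f \<in> value_set (Pi\<^sub>E J X) (u_prod J u)"
  then obtain x y where x: "x \<in> Pi\<^sub>E J X" and y: "y \<in> Pi\<^sub>E J X" and f: "f = u_prod J u x y"
    unfolding value_set_def by blast
  show "f \<in> Pi\<^sub>E J (\<lambda>j. value_set (X j) (u j))"
    unfolding f u_prod_def restrict_PiE_iff value_set_def
    using PiE_mem[OF x] PiE_mem[OF y] by blast
next
  fix f assume f: "f \<in> Pi\<^sub>E J (\<lambda>j. value_set (X j) (u j))"
  have "\<exists>x y. x \<in> X j \<and> y \<in> X j \<and> f j = u j x y" if "j \<in> J" for j
    using PiE_mem[OF f that] unfolding value_set_def by blast
  then obtain a b where ab: "\<And>j. j \<in> J \<Longrightarrow> a j \<in> X j \<and> b j \<in> X j \<and> f j = u j (a j) (b j)"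
    by metis
  have "u_prod J u (restrict a J) (restrict b J) = restrict f J"
    unfolding u_prod_def using ab by (intro restrict_ext) simp
  also have "\<dots> = f" using f by (rule PiE_restrict)
  finally have "f = u_prod J u (restrict a J) (restrict b J)" by simp
  moreover have "restrict a J \<in> Pi\<^sub>E J X" "restrict b J \<in> Pi\<^sub>E J X"
    using ab by (simp_all add: restrict_PiE_iff)
  ultimately show "f \<in> value_set (Pi\<^sub>E J X) (u_prod J u)" unfolding value_set_def by blast
qed

lemma ultrametric_on_u_prod:
  assumes um: "\<And>j. j \<in> J \<Longrightarrow> ultrametric_on (X j) (u j) (G j) (r j) (z j)"
  shows "ultrametric_on (Pi\<^sub>E J X) (u_prod J u) (Pi\<^sub>E J G) (prod_order J G r) (restrict z J)"
proof -
  have ne: "X j \<noteq> {}" and re: "refl_on (G j) (r j)" and tr: "trans (r j)"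
    and as: "antisym (r j)" and z: "z j \<in> G j" if "j \<in> J" for j
    using um[OF that] unfolding ultrametric_on_def order_on_defs by blast+
  have least: "(z j, \<gamma>) \<in> r j" if "j \<in> J" "\<gamma> \<in> G j" for j \<gamma>
    using um[OF that(1)] that(2) unfolding ultrametric_on_def by blast
  have val: "u j x y \<in> G j" and u1: "u j x y = z j \<longleftrightarrow> x = y" and u3: "u j x y = u j y x"
    if "j \<in> J" "x \<in> X j" "y \<in> X j" for j x y
    using um[OF that(1)] that(2,3) unfolding ultrametric_on_def by blast+
  have u2: "(u j x w, \<gamma>) \<in> r j"
    if "j \<in> J" "x \<in> X j" "y \<in> X j" "w \<in> X j" "\<gamma> \<in> G j"
      "(u j x y, \<gamma>) \<in> r j" "(u j y w, \<gamma>) \<in> r j" for j x y w \<gamma>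
    using um[OF that(1)] that(2-) unfolding ultrametric_on_def by blast
  have mem: "u_prod J u x y \<in> Pi\<^sub>E J G" if "x \<in> Pi\<^sub>E J X" "y \<in> Pi\<^sub>E J X" for x y
    unfolding u_prod_def restrict_PiE_iff using val PiE_mem[OF that(1)] PiE_mem[OF that(2)] by blast
  have po_iff: "(f, g) \<in> prod_order J G r \<longleftrightarrow>
      f \<in> Pi\<^sub>E J G \<and> g \<in> Pi\<^sub>E J G \<and> (\<forall>j\<in>J. (f j, g j) \<in> r j)" for f g
    unfolding prod_order_def by simp
  show ?thesis
    unfolding ultrametric_on_def partial_order_on_def preorder_on_def
  proof (intro conjI ballI impI)
    show "Pi\<^sub>E J X \<noteq> {}" using ne by (simp add: PiE_eq_empty_iff)
    show "prod_order J G r \<subseteq> Pi\<^sub>E J G \<times> Pi\<^sub>E J G" by (auto simp: po_iff)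
    show "refl_on (Pi\<^sub>E J G) (prod_order J G r)"
    proof (rule refl_onI)
      fix f assume "f \<in> Pi\<^sub>E J G"
      then show "(f, f) \<in> prod_order J G r"
        unfolding po_iff using refl_onD[OF re] PiE_mem[of f J G] by simp
    qed
    show "trans (prod_order J G r)"
    proof (rule transI)
      fix f g h assume fg: "(f, g) \<in> prod_order J G r" and gh: "(g, h) \<in> prod_order J G r"
      have "(f j, h j) \<in> r j" if j: "j \<in> J" for j
        using transD[OF tr[OF j], of "f j" "g j" "h j"] fg gh j by (simp add: po_iff)
      then show "(f, h) \<in> prod_order J G r" using fg gh by (simp add: po_iff)
    qed
    show "antisym (prod_order J G r)"
    proof (rule antisymI)
      fix f g assume fg: "(f, g) \<in> prod_order J G r" and gf: "(g, f) \<in> prod_order J G r"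
      have "f j = g j" if j: "j \<in> J" for j
        using antisymD[OF as[OF j], of "f j" "g j"] fg gf j by (simp add: po_iff)
      then show "f = g" using fg PiE_ext[of f J G g] by (simp add: po_iff)
    qed
    show zm: "restrict z J \<in> Pi\<^sub>E J G" using z by (simp add: restrict_PiE_iff)
    show "(restrict z J, \<gamma>) \<in> prod_order J G r" if "\<gamma> \<in> Pi\<^sub>E J G" for \<gamma>
      using that zm least PiE_mem[OF that] by (simp add: po_iff)
  next
    fix x y assume x: "x \<in> Pi\<^sub>E J X" and y: "y \<in> Pi\<^sub>E J X"
    show "u_prod J u x y \<in> Pi\<^sub>E J G" using mem x y .
    have "u_prod J u x y = restrict z J \<longleftrightarrow> (\<forall>j\<in>J. u j (x j) (y j) = z j)"
      unfolding u_prod_def restrict_def fun_eq_iff by auto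
    also have "\<dots> \<longleftrightarrow> (\<forall>j\<in>J. x j = y j)" using u1[OF _ PiE_mem[OF x] PiE_mem[OF y]] by simp
    also have "\<dots> \<longleftrightarrow> x = y" using PiE_ext[OF x y] by auto
    finally show "u_prod J u x y = restrict z J \<longleftrightarrow> x = y" .
    show "u_prod J u x y = u_prod J u y x"
      unfolding u_prod_def using u3[OF _ PiE_mem[OF x] PiE_mem[OF y]] by (intro restrict_ext)
  next
    fix x y w \<gamma>
    assume x: "x \<in> Pi\<^sub>E J X" and y: "y \<in> Pi\<^sub>E J X" and w: "w \<in> Pi\<^sub>E J X" and g: "\<gamma> \<in> Pi\<^sub>E J G"
      and xy: "(u_prod J u x y, \<gamma>) \<in> prod_order J G r"
      and yw: "(u_prod J u y w, \<gamma>) \<in> prod_order J G r"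
    have "(u j (x j) (w j), \<gamma> j) \<in> r j" if j: "j \<in> J" for j
      using u2[OF j PiE_mem[OF x j] PiE_mem[OF y j] PiE_mem[OF w j] PiE_mem[OF g j]]
        xy yw j by (simp add: po_iff u_prod_def)
    then show "(u_prod J u x w, \<gamma>) \<in> prod_order J G r"
      using mem[OF x w] g by (simp add: po_iff u_prod_def)
  qed
qed

lemma value_set_u_max:
  assumes fin: "finite J" and "J \<noteq> {}" and lin: "linear_order_on \<Gamma> R"
    and um: "\<And>j. j \<in> J \<Longrightarrow> ultrametric_on (X j) (u j) (value_set (X j) (u j)) (r j) c"
    and sub: "\<And>j. j \<in> J \<Longrightarrow> value_set (X j) (u j) \<subseteq> \<Gamma>"
    and r: "\<And>j. j \<in> J \<Longrightarrow> r j = Restr R (value_set (X j) (u j))"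
  shows "value_set (Pi\<^sub>E J X) (u_max R J u) = (\<Union>j\<in>J. value_set (X j) (u j))"
proof (intro equalityI subsetI)
  have val: "u j x y \<in> value_set (X j) (u j)" if "x \<in> X j" "y \<in> X j" for j x y
    using that unfolding value_set_def by blast
  fix g assume "g \<in> value_set (Pi\<^sub>E J X) (u_max R J u)"
  then obtain x y where x: "x \<in> Pi\<^sub>E J X" and y: "y \<in> Pi\<^sub>E J X" and g: "g = u_max R J u x y"
    unfolding value_set_def by blast
  have S: "(\<lambda>j. u j (x j) (y j)) ` J \<subseteq> \<Gamma>"
    using sub val PiE_mem[OF x] PiE_mem[OF y] by blast
  have "g \<in> (\<lambda>j. u j (x j) (y j)) ` J"
    unfolding g u_max_def using max_wrt(1)[OF lin _ _ S] fin \<open>J \<noteq> {}\<close> by simp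
  then show "g \<in> (\<Union>j\<in>J. value_set (X j) (u j))"
    using val PiE_mem[OF x] PiE_mem[OF y] by blast
next
  fix g assume "g \<in> (\<Union>j\<in>J. value_set (X j) (u j))"
  then obtain i a b where i: "i \<in> J" and a: "a \<in> X i" and b: "b \<in> X i" and g: "g = u i a b"
    unfolding value_set_def by blast
  have gv: "g \<in> value_set (X i) (u i)" using a b g unfolding value_set_def by blast
  have "\<exists>p. p \<in> X j" if "j \<in> J" for j using um[OF that] unfolding ultrametric_on_def by blast
  then obtain p where p: "\<And>j. j \<in> J \<Longrightarrow> p j \<in> X j" by metis
  define x where "x = (\<lambda>j\<in>J. if j = i then a else p j)"
  define y where "y = (\<lambda>j\<in>J. if j = i then b else p j)"
  have xy: "x \<in> Pi\<^sub>E J X" "y \<in> Pi\<^sub>E J X"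
    using p a b by (auto simp: x_def y_def)
  have pp: "u j (p j) (p j) = c" if "j \<in> J" for j
    using um[OF that] p[OF that] unfolding ultrametric_on_def by blast
  have c: "(c, g) \<in> R" "c \<in> \<Gamma>" "g \<in> \<Gamma>"
    using um[OF i] gv r[OF i] sub[OF i] unfolding ultrametric_on_def by blast+
  have vals: "(\<lambda>j. u j (x j) (y j)) ` J \<subseteq> {c, g}" and gin: "g \<in> (\<lambda>j. u j (x j) (y j)) ` J"
    using i pp by (auto simp: x_def y_def g image_iff)
  have S: "(\<lambda>j. u j (x j) (y j)) ` J \<subseteq> \<Gamma>" using vals c by blast
  let ?m = "max_wrt R ((\<lambda>j. u j (x j) (y j)) ` J)"
  have "?m \<in> {c, g}" using max_wrt(1)[OF lin _ _ S] fin \<open>J \<noteq> {}\<close> vals by blast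
  moreover have "(g, ?m) \<in> R" using max_wrt(2)[OF lin _ _ S gin] fin \<open>J \<noteq> {}\<close> by simp
  moreover have "antisym R" using lin by (simp add: order_on_defs)
  ultimately have "?m = g" using c(1) by (auto dest: antisymD)
  then show "g \<in> value_set (Pi\<^sub>E J X) (u_max R J u)"
    using xy unfolding value_set_def u_max_def by blast
qed

lemma ultrametric_on_u_max:
  assumes fin: "finite J" and "J \<noteq> {}" and lin: "linear_order_on \<Gamma> R"
    and um: "\<And>j. j \<in> J \<Longrightarrow> ultrametric_on (X j) (u j) (value_set (X j) (u j)) (r j) c"
    and sub: "\<And>j. j \<in> J \<Longrightarrow> value_set (X j) (u j) \<subseteq> \<Gamma>"
    and r: "\<And>j. j \<in> J \<Longrightarrow> r j = Restr R (value_set (X j) (u j))"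
  defines "V \<equiv> (\<Union>j\<in>J. value_set (X j) (u j))"
  shows "ultrametric_on (Pi\<^sub>E J X) (u_max R J u) V (Restr R V) c"
proof -
  have re: "refl_on \<Gamma> R" and tr: "trans R" and as: "antisym R" and tot: "total_on \<Gamma> R"
    using lin unfolding order_on_defs by blast+
  have VG: "V \<subseteq> \<Gamma>" unfolding V_def using sub by blast
  have val: "u j x y \<in> value_set (X j) (u j)" if "x \<in> X j" "y \<in> X j" for j x y
    using that unfolding value_set_def by blast
  have ne: "X j \<noteq> {}" and cv: "c \<in> value_set (X j) (u j)" if "j \<in> J" for j
    using um[OF that] unfolding ultrametric_on_def by blast+
  have least: "(c, \<gamma>) \<in> R" if "\<gamma> \<in> V" for \<gamma>
  proof -
    from that obtain j where "j \<in> J" "\<gamma> \<in> value_set (X j) (u j)" unfolding V_def by blast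
    then show ?thesis using um[of j] r[of j] unfolding ultrametric_on_def by blast
  qed
  have u1: "u j x y = c \<longleftrightarrow> x = y" and u3: "u j x y = u j y x"
    if "j \<in> J" "x \<in> X j" "y \<in> X j" for j x y
    using um[OF that(1)] that(2,3) unfolding ultrametric_on_def by blast+
  have u2: "(u j x w, \<gamma>) \<in> R"
    if j: "j \<in> J" and x: "x \<in> X j" "y \<in> X j" "w \<in> X j"
      and l: "(u j x y, \<gamma>) \<in> R" "(u j y w, \<gamma>) \<in> R" for j x y w \<gamma>
  proof -
    let ?W = "value_set (X j) (u j)"
    have v: "u j x y \<in> ?W" "u j y w \<in> ?W" "u j x w \<in> ?W" using val x by blast+
    have *: "(u j x w, \<delta>) \<in> R" if "\<delta> \<in> ?W" "(u j x y, \<delta>) \<in> R" "(u j y w, \<delta>) \<in> R" for \<delta>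
    proof -
      have "(u j x y, \<delta>) \<in> r j" "(u j y w, \<delta>) \<in> r j" using that v r[OF j] by simp_all
      then have "(u j x w, \<delta>) \<in> r j"
        using um[OF j] x that(1) unfolding ultrametric_on_def by blast
      then show ?thesis using r[OF j] by simp
    qed
    have G: "u j x y \<in> \<Gamma>" "u j y w \<in> \<Gamma>" using v sub[OF j] by blast+
    then have refl: "(u j x y, u j x y) \<in> R" "(u j y w, u j y w) \<in> R"
      using refl_onD[OF re] by blast+
    have "(u j x y, u j y w) \<in> R \<or> (u j y w, u j x y) \<in> R"
      using tot G refl unfolding total_on_def by (cases "u j x y = u j y w") simp_all
    then show ?thesis
    proof
      assume "(u j x y, u j y w) \<in> R"
      then show ?thesis using transD[OF tr *[OF v(2) _ refl(2)] l(2)] by blast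
    next
      assume "(u j y w, u j x y) \<in> R"
      then show ?thesis using transD[OF tr *[OF v(1) refl(1)] l(1)] by blast
    qed
  qed
  have le_iff: "(u_max R J u x y, \<gamma>) \<in> R \<longleftrightarrow> (\<forall>j\<in>J. (u j (x j) (y j), \<gamma>) \<in> R)"
    and mx: "u_max R J u x y \<in> V"
    if x: "x \<in> Pi\<^sub>E J X" and y: "y \<in> Pi\<^sub>E J X" for x y \<gamma>
  proof -
    have SV: "(\<lambda>j. u j (x j) (y j)) ` J \<subseteq> V"
      unfolding V_def using val PiE_mem[OF x] PiE_mem[OF y] by blast
    then have S: "(\<lambda>j. u j (x j) (y j)) ` J \<subseteq> \<Gamma>" using VG by blast
    have m: "u_max R J u x y \<in> (\<lambda>j. u j (x j) (y j)) ` J"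
      "\<And>j. j \<in> J \<Longrightarrow> (u j (x j) (y j), u_max R J u x y) \<in> R"
      using max_wrt[OF lin _ _ S] fin \<open>J \<noteq> {}\<close> unfolding u_max_def by simp_all
    show "(u_max R J u x y, \<gamma>) \<in> R \<longleftrightarrow> (\<forall>j\<in>J. (u j (x j) (y j), \<gamma>) \<in> R)"
    proof
      assume "(u_max R J u x y, \<gamma>) \<in> R"
      then show "\<forall>j\<in>J. (u j (x j) (y j), \<gamma>) \<in> R" using transD[OF tr m(2)] by simp
    next
      assume "\<forall>j\<in>J. (u j (x j) (y j), \<gamma>) \<in> R"
      then show "(u_max R J u x y, \<gamma>) \<in> R" using m(1) by auto
    qed
    show "u_max R J u x y \<in> V" using m SV by blast
  qed
  show ?thesis
    unfolding ultrametric_on_def partial_order_on_def preorder_on_def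
  proof (intro conjI ballI impI)
    show "Pi\<^sub>E J X \<noteq> {}" using ne by (simp add: PiE_eq_empty_iff)
    show "Restr R V \<subseteq> V \<times> V" by blast
    show "refl_on V (Restr R V)" using re VG unfolding refl_on_def by blast
    show "trans (Restr R V)" using tr unfolding trans_def by blast
    show "antisym (Restr R V)" using as unfolding antisym_def by blast
    show cV: "c \<in> V" unfolding V_def using cv \<open>J \<noteq> {}\<close> by blast
    show "(c, \<gamma>) \<in> Restr R V" if "\<gamma> \<in> V" for \<gamma> using that least cV by blast
  next
    fix x y assume x: "x \<in> Pi\<^sub>E J X" and y: "y \<in> Pi\<^sub>E J X"
    show "u_max R J u x y \<in> V" using mx x y .
    have vV: "u j (x j) (y j) \<in> V" if "j \<in> J" for j
      unfolding V_def using val[OF PiE_mem[OF x that] PiE_mem[OF y that]] that by blast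
    have cc: "(c, c) \<in> R"
    proof -
      have "c \<in> V" unfolding V_def using cv \<open>J \<noteq> {}\<close> by blast
      then show ?thesis by (rule least)
    qed
    have "u_max R J u x y = c \<longleftrightarrow> (u_max R J u x y, c) \<in> R"
      using least[OF mx[OF x y]] cc antisymD[OF as, of "u_max R J u x y" c] by auto
    also have "\<dots> \<longleftrightarrow> (\<forall>j\<in>J. u j (x j) (y j) = c)"
      unfolding le_iff[OF x y] using cc antisymD[OF as _ least[OF vV]] by auto
    also have "\<dots> \<longleftrightarrow> (\<forall>j\<in>J. x j = y j)" using u1[OF _ PiE_mem[OF x] PiE_mem[OF y]] by simp
    also have "\<dots> \<longleftrightarrow> x = y" using PiE_ext[OF x y] by auto
    finally show "u_max R J u x y = c \<longleftrightarrow> x = y" .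
    have "(\<lambda>j. u j (x j) (y j)) ` J = (\<lambda>j. u j (y j) (x j)) ` J"
      using u3 PiE_mem[OF x] PiE_mem[OF y] by (intro image_cong) simp_all
    then show "u_max R J u x y = u_max R J u y x" unfolding u_max_def by simp
  next
    fix x y w \<gamma>
    assume x: "x \<in> Pi\<^sub>E J X" and y: "y \<in> Pi\<^sub>E J X" and w: "w \<in> Pi\<^sub>E J X" and g: "\<gamma> \<in> V"
      and "(u_max R J u x y, \<gamma>) \<in> Restr R V" "(u_max R J u y w, \<gamma>) \<in> Restr R V"
    then have "\<forall>j\<in>J. (u j (x j) (y j), \<gamma>) \<in> R" "\<forall>j\<in>J. (u j (y j) (w j), \<gamma>) \<in> R"
      using le_iff[OF x y] le_iff[OF y w] by blast+
    then have "\<forall>j\<in>J. (u j (x j) (w j), \<gamma>) \<in> R"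
      using u2[OF _ PiE_mem[OF x] PiE_mem[OF y] PiE_mem[OF w]] by simp
    then have "(u_max R J u x w, \<gamma>) \<in> R"
      unfolding le_iff[OF x w] .
    then show "(u_max R J u x w, \<gamma>) \<in> Restr R V" using mx[OF x w] g by blast
  qed
qed

end

theory Submission
  imports Defs
begin

text \<open>
  A ball of the product ultrametric is a product of balls, one from each factor. Hence a nest of
  balls in the product projects to a nest in every factor, and points of the factor intersections
  assemble to a point of the product intersection. Conversely a nest in the factor \<open>X i\<close> lifts to
  the product by freezing the other coordinates: a single point \<open>p j\<close> is the ball of radius zero.

  The maximum ultrametric needs more care, because a ball of radius \<open>\<alpha>\<close> has the \<^emph>\<open>same\<close> radius
  \<open>\<alpha>\<close> in every coordinate, and \<open>\<alpha>\<close> is a value of some factor only. Its projection to another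
  factor \<open>X j\<close> is a ball whose radius lies in the union \<open>V\<close> of the value sets but perhaps not in
  the value set of \<open>X j\<close>; such a set need not be a closed ball of \<open>X j\<close>. Two facts about
  totally ordered values overcome this. Balls that meet are comparable (lemma
  \<open>uballs_meet_comparable\<close>), so a family of balls is a nest as soon as its members pairwise meet.
  And between two distinct nested balls with radii in \<open>V\<close> lies a closed ball whose radius is an
  actual distance (lemma \<open>closed_uball_between\<close>), so that nests with radii in \<open>V\<close> have nonempty
  intersection in a spherically complete space (lemma \<open>nest_of_uballs_Inter_nonempty\<close>).
\<close>

section \<open>Balls and nests\<close>

lemma value_set_subset:
  assumes "ultrametric_on X u V s z" shows "value_set X u \<subseteq> V"
  using assms unfolding ultrametric_on_def value_set_def by blast

lemma closed_uball_obtain: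
  assumes "ultrametric_on X u V s z" "B \<in> closed_uballs X u s"
  obtains \<alpha> x where "\<alpha> \<in> V" "x \<in> X" "B = uball X u s \<alpha> x"
  using assms(2) value_set_subset[OF assms(1)] unfolding closed_uballs_def by blast

lemma uball_center:
  assumes "ultrametric_on X u V s z" "x \<in> X" "\<alpha> \<in> V"
  shows "x \<in> uball X u s \<alpha> x"
proof -
  have "u x x = z" "(z, \<alpha>) \<in> s" using assms unfolding ultrametric_on_def by blast+
  then show ?thesis using assms(2) by (simp add: uball_def)
qed

lemma zero_mem_value_set:
  assumes "ultrametric_on X u V s z" shows "z \<in> value_set X u"
proof -
  obtain x where "x \<in> X" using assms unfolding ultrametric_on_def by blast
  moreover have "u x x = z" using assms \<open>x \<in> X\<close> unfolding ultrametric_on_def by blast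
  ultimately show ?thesis unfolding value_set_def by blast
qed

lemma uball_zero:
  assumes "ultrametric_on X u V s z" "x \<in> X"
  shows "uball X u s z x = {x}"
proof -
  have "antisym s" and z: "z \<in> V" using assms unfolding ultrametric_on_def order_on_defs by blast+
  have "y = x" if "y \<in> X" "(u x y, z) \<in> s" for y
  proof -
    have "(z, u x y) \<in> s" using assms that(1) unfolding ultrametric_on_def by blast
    then have "u x y = z" using \<open>antisym s\<close> that(2) by (rule antisymD[rotated 2])
    then show ?thesis using assms that(1) unfolding ultrametric_on_def by blast
  qed
  then show ?thesis using uball_center[OF assms z] by (auto simp: uball_def)
qed

text \<open>Every point of an ultrametric ball is a center of it. Seen from the common point \<open>w\<close>, both
  balls are concentric, and only their radii have to be compared.\<close>

lemma uball_subset_uball: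
  assumes um: "ultrametric_on X u V s z"
    and x: "x \<in> X" and y: "y \<in> X" and \<beta>: "\<beta> \<in> V"
    and le: "(\<alpha>, \<beta>) \<in> s" and w: "w \<in> uball X u s \<alpha> x" "w \<in> uball X u s \<beta> y"
  shows "uball X u s \<alpha> x \<subseteq> uball X u s \<beta> y"
proof
  fix v assume v: "v \<in> uball X u s \<alpha> x"
  have tr: "trans s" using um unfolding ultrametric_on_def order_on_defs by blast
  have u2: "(u a c, \<beta>) \<in> s" if "a \<in> X" "b \<in> X" "c \<in> X" "(u a b, \<beta>) \<in> s" "(u b c, \<beta>) \<in> s" for a b c
    using um \<beta> that unfolding ultrametric_on_def by blast
  have X: "v \<in> X" "w \<in> X" using v w by (simp_all add: uball_def)
  have "(u x w, \<beta>) \<in> s" "(u x v, \<beta>) \<in> s" "(u y w, \<beta>) \<in> s"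
    using v w transD[OF tr _ le] by (simp_all add: uball_def)
  moreover have "u x w = u w x" using um x X unfolding ultrametric_on_def by blast
  ultimately have "(u w v, \<beta>) \<in> s" "(u y w, \<beta>) \<in> s" using u2[of w x v] x X by simp_all
  then show "v \<in> uball X u s \<beta> y" using u2[of y w v] y X by (simp add: uball_def)
qed

lemma uballs_meet_comparable:
  assumes um: "ultrametric_on X u V s z" and tot: "total_on V s"
    and x: "x \<in> X" "\<alpha> \<in> V" and y: "y \<in> X" "\<beta> \<in> V"
    and meet: "uball X u s \<alpha> x \<inter> uball X u s \<beta> y \<noteq> {}"
  shows "uball X u s \<alpha> x \<subseteq> uball X u s \<beta> y \<or> uball X u s \<beta> y \<subseteq> uball X u s \<alpha> x"
proof -
  obtain w where w: "w \<in> uball X u s \<alpha> x" "w \<in> uball X u s \<beta> y" using meet by blast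
  have "refl_on V s" using um unfolding ultrametric_on_def order_on_defs by blast
  then have "(\<alpha>, \<beta>) \<in> s \<or> (\<beta>, \<alpha>) \<in> s"
    using tot x(2) y(2) unfolding total_on_def by (cases "\<alpha> = \<beta>") (simp_all add: refl_onD)
  then show ?thesis
    using uball_subset_uball[OF um x(1) y(1) y(2) _ w]
      uball_subset_uball[OF um y(1) x(1) x(2) _ w(2,1)] by blast
qed

lemma spherically_completeD:
  assumes "spherically_complete X u s" "N \<noteq> {}" "N \<subseteq> closed_uballs X u s"
    and "\<And>B C. B \<in> N \<Longrightarrow> C \<in> N \<Longrightarrow> B \<subseteq> C \<or> C \<subseteq> B"
  shows "\<Inter>N \<noteq> {}"
  using assms by (simp add: spherically_complete_def chain_subset_def)

text \<open>Balls only compare distances with distances, so comparisons involving other values do not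
  influence spherical completeness. This allows one order to be used on all factors at once.\<close>

lemma spherically_complete_Restr:
  assumes "value_set X u \<subseteq> W"
  shows "spherically_complete X u (Restr R W) \<longleftrightarrow> spherically_complete X u R"
proof -
  have "uball X u (Restr R W) \<alpha> x = uball X u R \<alpha> x" if "\<alpha> \<in> value_set X u" "x \<in> X" for \<alpha> x
    using assms that unfolding uball_def value_set_def by blast
  then have "closed_uballs X u (Restr R W) = closed_uballs X u R"
    unfolding closed_uballs_def by (intro Collect_cong iff_exI) metis
  then show ?thesis by (simp add: spherically_complete_def)
qed

section \<open>Radii outside the value set\<close>

text \<open>For \<open>w\<close> in the larger but not in the smaller ball, the distance of \<open>w\<close> from the
  center \<open>x\<close> of the smaller one exceeds \<open>\<alpha>\<close>, since the order is total, and is bounded by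
  \<open>\<beta>\<close>, since \<open>x\<close> is also a center of the larger ball. So this distance is a suitable radius.\<close>

lemma closed_uball_between:
  assumes um: "ultrametric_on X u V s z" and tot: "total_on V s"
    and x: "x \<in> X" "\<alpha> \<in> V" and y: "y \<in> X" "\<beta> \<in> V"
    and less: "uball X u s \<alpha> x \<subset> uball X u s \<beta> y"
  obtains D where "D \<in> closed_uballs X u s" "uball X u s \<alpha> x \<subseteq> D" "D \<subseteq> uball X u s \<beta> y"
proof -
  obtain w where w: "w \<in> uball X u s \<beta> y" "w \<notin> uball X u s \<alpha> x" using less by blast
  define \<delta> where "\<delta> = u x w"
  have wX: "w \<in> X" using w by (simp add: uball_def)
  have \<delta>: "\<delta> \<in> value_set X u" using x wX unfolding \<delta>_def value_set_def by blast
  then have \<delta>V: "\<delta> \<in> V" using value_set_subset[OF um] by blast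
  have re: "refl_on V s" using um unfolding ultrametric_on_def order_on_defs by blast
  have "(\<delta>, \<alpha>) \<notin> s" using w wX by (simp add: \<delta>_def uball_def)
  then have le: "(\<alpha>, \<delta>) \<in> s"
    using tot x(2) \<delta>V re unfolding total_on_def by (cases "\<alpha> = \<delta>") (auto simp: refl_onD)
  have cx: "x \<in> uball X u s \<alpha> x" "x \<in> uball X u s \<delta> x"
    using uball_center[OF um x(1)] x(2) \<delta>V by blast+
  have xb: "x \<in> uball X u s \<beta> y" using cx less by blast
  have "uball X u s \<beta> y \<subseteq> uball X u s \<beta> x"
    using uball_subset_uball[OF um y(1) x(1) y(2) _ xb uball_center[OF um x(1) y(2)]]
      refl_onD[OF re y(2)] by blast
  then have "(\<delta>, \<beta>) \<in> s" using w(1) by (auto simp: \<delta>_def uball_def)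
  then have "uball X u s \<delta> x \<subseteq> uball X u s \<beta> y"
    by (rule uball_subset_uball[OF um x(1) y(1) y(2) _ cx(2) xb])
  moreover have "uball X u s \<alpha> x \<subseteq> uball X u s \<delta> x"
    by (rule uball_subset_uball[OF um x(1) x(1) \<delta>V le cx])
  moreover have "uball X u s \<delta> x \<in> closed_uballs X u s"
    using \<delta> x(1) unfolding closed_uballs_def by blast
  ultimately show thesis using that by blast
qed

text \<open>Spherical completeness only speaks of radii that are distances. A nest with arbitrary radii
  either has a smallest member, which is inhabited, or all closed balls that contain a member of the
  nest form a nest, because they pairwise meet; by interpolation every member of the given nest
  contains one of them.\<close>

lemma nest_of_uballs_Inter_nonempty:
  assumes um: "ultrametric_on X u V s z" and tot: "total_on V s"
    and sc: "spherically_complete X u s"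
    and ne: "N \<noteq> {}"
    and balls: "\<And>B. B \<in> N \<Longrightarrow> \<exists>\<alpha>\<in>V. \<exists>x\<in>X. B = uball X u s \<alpha> x"
    and nest: "\<And>B C. B \<in> N \<Longrightarrow> C \<in> N \<Longrightarrow> B \<subseteq> C \<or> C \<subseteq> B"
  shows "\<Inter>N \<noteq> {}"
proof -
  have inh: "B \<noteq> {}" if "B \<in> N" for B
    using balls[OF that] uball_center[OF um] by blast
  show ?thesis
  proof (cases "\<exists>M\<in>N. \<forall>B\<in>N. M \<subseteq> B")
    case True
    then show ?thesis using inh by blast
  next
    case False
    define L where "L = {D \<in> closed_uballs X u s. \<exists>B\<in>N. B \<subseteq> D}"
    have between: "\<exists>D\<in>L. D \<subseteq> B" if B: "B \<in> N" for B
    proof -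
      obtain C where "C \<in> N" "\<not> B \<subseteq> C" using False B by blast
      then have C: "C \<in> N" "C \<subset> B" using nest[OF B, of C] by auto
      obtain \<alpha> x where x: "\<alpha> \<in> V" "x \<in> X" "C = uball X u s \<alpha> x" using balls[OF C(1)] by blast
      obtain \<beta> y where y: "\<beta> \<in> V" "y \<in> X" "B = uball X u s \<beta> y" using balls[OF B] by blast
      obtain D where "D \<in> closed_uballs X u s" "C \<subseteq> D" "D \<subseteq> B"
        using closed_uball_between[OF um tot x(2,1) y(2,1)] C(2) unfolding x(3) y(3) by metis
      then show ?thesis using C(1) unfolding L_def by blast
    qed
    have "L \<noteq> {}" using ne between by blast
    moreover have "L \<subseteq> closed_uballs X u s" unfolding L_def by blast
    moreover have "D \<subseteq> E \<or> E \<subseteq> D" if DE: "D \<in> L" "E \<in> L" for D E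
    proof -
      obtain B C where BC: "B \<in> N" "C \<in> N" "B \<subseteq> D" "C \<subseteq> E" using DE unfolding L_def by blast
      then have "B \<inter> C \<noteq> {}" using nest[OF BC(1,2)] inh[OF BC(1)] inh[OF BC(2)] by blast
      then have meet: "D \<inter> E \<noteq> {}" using BC by blast
      have "D \<in> closed_uballs X u s" "E \<in> closed_uballs X u s"
        using DE unfolding L_def by simp_all
      then obtain \<alpha> x \<beta> y where x: "\<alpha> \<in> V" "x \<in> X" "D = uball X u s \<alpha> x"
        and y: "\<beta> \<in> V" "y \<in> X" "E = uball X u s \<beta> y"
        by (elim closed_uball_obtain[OF um])
      show ?thesis
        using uballs_meet_comparable[OF um tot x(2,1) y(2,1)] meet unfolding x(3) y(3) by blast
    qed
    ultimately have "\<Inter>L \<noteq> {}" by (rule spherically_completeD[OF sc])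
    then show ?thesis using between by blast
  qed
qed

section \<open>The product ultrametric\<close>

text \<open>Inclusion between products of nonempty sets is inclusion in each coordinate. Hence the
  coordinates of a nest of such products form nests, and a common point can be found coordinate by
  coordinate.\<close>

lemma nest_of_products_Inter_nonempty:
  assumes nest: "chain\<^sub>\<subseteq> N"
    and F: "\<And>C. C \<in> N \<Longrightarrow> C = Pi\<^sub>E J (F C)"
    and inh: "\<And>C j. C \<in> N \<Longrightarrow> j \<in> J \<Longrightarrow> F C j \<noteq> {}"
    and coord: "\<And>j. j \<in> J \<Longrightarrow>
      (\<And>A B. A \<in> (\<lambda>C. F C j) ` N \<Longrightarrow> B \<in> (\<lambda>C. F C j) ` N \<Longrightarrow> A \<subseteq> B \<or> B \<subseteq> A) \<Longrightarrow>
      \<Inter>((\<lambda>C. F C j) ` N) \<noteq> {}"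
  shows "\<Inter>N \<noteq> {}"
proof -
  have mono: "F C j \<subseteq> F D j" if "C \<subseteq> D" "C \<in> N" "D \<in> N" "j \<in> J" for C D j
  proof -
    have "Pi\<^sub>E J (F C) \<subseteq> Pi\<^sub>E J (F D)" 
      unfolding F[OF that(2), symmetric] F[OF that(3), symmetric] by (rule that(1))
    then show ?thesis
      using inh[OF that(2)] that(4) by (simp add: subset_PiE PiE_eq_empty_iff)
  qed
  have "\<exists>p. \<forall>C\<in>N. p \<in> F C j" if j: "j \<in> J" for j
  proof -
    have "\<Inter>((\<lambda>C. F C j) ` N) \<noteq> {}"
    proof (rule coord[OF j], elim imageE)
      fix A B C D assume "A = F C j" "C \<in> N" "B = F D j" "D \<in> N"
      moreover have "C \<subseteq> D \<or> D \<subseteq> C"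
        using nest \<open>C \<in> N\<close> \<open>D \<in> N\<close> by (simp add: chain_subset_def)
      ultimately show "A \<subseteq> B \<or> B \<subseteq> A" using mono[of C D j] mono[of D C j] j by auto
    qed
    then show ?thesis by auto
  qed
  then have "\<forall>j\<in>J. \<exists>p. \<forall>C\<in>N. p \<in> F C j" by simp
  from bchoice[OF this] obtain p where p: "\<forall>j\<in>J. \<forall>C\<in>N. p j \<in> F C j" ..
  have "restrict p J \<in> C" if "C \<in> N" for C
  proof -
    have "restrict p J \<in> Pi\<^sub>E J (F C)" using p that by (simp add: restrict_PiE_iff)
    then show ?thesis unfolding F[OF that, symmetric] .
  qed
  then show ?thesis by blast
qed

lemma uball_u_prod:
  assumes x: "x \<in> Pi\<^sub>E J X" and \<alpha>: "\<alpha> \<in> Pi\<^sub>E J (\<lambda>j. value_set (X j) (u j))"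
  shows "uball (Pi\<^sub>E J X) (u_prod J u) (prod_order J (\<lambda>j. value_set (X j) (u j)) r) \<alpha> x
    = Pi\<^sub>E J (\<lambda>j. uball (X j) (u j) (r j) (\<alpha> j) (x j))"
proof -
  have "u_prod J u x y \<in> Pi\<^sub>E J (\<lambda>j. value_set (X j) (u j))" if "y \<in> Pi\<^sub>E J X" for y
    using x that unfolding value_set_u_prod[symmetric] value_set_def[of "Pi\<^sub>E J X"] by blast
  then have "(u_prod J u x y, \<alpha>) \<in> prod_order J (\<lambda>j. value_set (X j) (u j)) r
      \<longleftrightarrow> (\<forall>j\<in>J. (u j (x j) (y j), \<alpha> j) \<in> r j)" if "y \<in> Pi\<^sub>E J X" for y
    using \<alpha> that by (simp add: prod_order_def u_prod_def)
  then have "uball (Pi\<^sub>E J X) (u_prod J u) (prod_order J (\<lambda>j. value_set (X j) (u j)) r) \<alpha> x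
      = {y \<in> Pi\<^sub>E J X. \<forall>j\<in>J. (u j (x j) (y j), \<alpha> j) \<in> r j}"
    unfolding uball_def by (intro Collect_cong conj_cong refl)
  also have "\<dots> = Pi\<^sub>E J (\<lambda>j. uball (X j) (u j) (r j) (\<alpha> j) (x j))"
    by (simp add: set_eq_iff uball_def PiE_iff ball_conj_distrib conj_ac)
  finally show ?thesis .
qed

lemma closed_uballs_u_prod:
  "closed_uballs (Pi\<^sub>E J X) (u_prod J u) (prod_order J (\<lambda>j. value_set (X j) (u j)) r)
    = {Pi\<^sub>E J B |B. \<forall>j\<in>J. B j \<in> closed_uballs (X j) (u j) (r j)}" (is "?L = ?R")
proof (intro equalityI subsetI)
  fix C assume "C \<in> ?L"
  then obtain \<alpha> x where \<alpha>: "\<alpha> \<in> Pi\<^sub>E J (\<lambda>j. value_set (X j) (u j))" and x: "x \<in> Pi\<^sub>E J X"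
    and "C = uball (Pi\<^sub>E J X) (u_prod J u) (prod_order J (\<lambda>j. value_set (X j) (u j)) r) \<alpha> x"
    unfolding closed_uballs_def value_set_u_prod by blast
  then have C: "C = Pi\<^sub>E J (\<lambda>j. uball (X j) (u j) (r j) (\<alpha> j) (x j))" by (simp add: uball_u_prod)
  have "uball (X j) (u j) (r j) (\<alpha> j) (x j) \<in> closed_uballs (X j) (u j) (r j)" if "j \<in> J" for j
    using PiE_mem[OF \<alpha> that] PiE_mem[OF x that] unfolding closed_uballs_def by blast
  then show "C \<in> ?R" unfolding C by blast
next
  fix C assume "C \<in> ?R"
  then obtain B where C: "C = Pi\<^sub>E J B" and B: "\<And>j. j \<in> J \<Longrightarrow> B j \<in> closed_uballs (X j) (u j) (r j)"
    by blast
  have "\<exists>\<alpha> x. \<alpha> \<in> value_set (X j) (u j) \<and> x \<in> X j \<and> B j = uball (X j) (u j) (r j) \<alpha> x"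
    if "j \<in> J" for j
    using B[OF that] unfolding closed_uballs_def by blast
  then obtain \<alpha> x where ax: "\<And>j. j \<in> J \<Longrightarrow>
      \<alpha> j \<in> value_set (X j) (u j) \<and> x j \<in> X j \<and> B j = uball (X j) (u j) (r j) (\<alpha> j) (x j)"
    by metis
  have \<alpha>: "restrict \<alpha> J \<in> Pi\<^sub>E J (\<lambda>j. value_set (X j) (u j))" and x: "restrict x J \<in> Pi\<^sub>E J X"
    using ax by (simp_all add: restrict_PiE_iff)
  have "C = Pi\<^sub>E J (\<lambda>j. uball (X j) (u j) (r j) (restrict \<alpha> J j) (restrict x J j))"
    unfolding C using ax by (intro PiE_cong) simp
  also have "\<dots> = uball (Pi\<^sub>E J X) (u_prod J u)
      (prod_order J (\<lambda>j. value_set (X j) (u j)) r) (restrict \<alpha> J) (restrict x J)"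
    by (rule uball_u_prod[OF x \<alpha>, symmetric])
  finally show "C \<in> ?L"
    using \<alpha> x unfolding closed_uballs_def value_set_u_prod mem_Collect_eq by (intro exI conjI)
qed

lemma spherically_complete_u_prod_iff:
  assumes um: "\<And>j. j \<in> J \<Longrightarrow> ultrametric_on (X j) (u j) (value_set (X j) (u j)) (r j) (z j)"
  shows "spherically_complete (Pi\<^sub>E J X) (u_prod J u) (prod_order J (\<lambda>j. value_set (X j) (u j)) r)
    \<longleftrightarrow> (\<forall>j\<in>J. spherically_complete (X j) (u j) (r j))" (is "?prod \<longleftrightarrow> ?all")
proof
  assume prod: ?prod
  show ?all
  proof
    fix i assume i: "i \<in> J"
    have "\<exists>p. p \<in> X j" if "j \<in> J" for j using um[OF that] unfolding ultrametric_on_def by blast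
    then obtain p where p: "\<And>j. j \<in> J \<Longrightarrow> p j \<in> X j" by metis
    have pt: "{p j} \<in> closed_uballs (X j) (u j) (r j)" if "j \<in> J" for j
      unfolding closed_uballs_def mem_Collect_eq
      using uball_zero[OF um[OF that] p[OF that], symmetric] zero_mem_value_set[OF um[OF that]]
        p[OF that] by (intro exI conjI)
    define lift where "lift B = Pi\<^sub>E J (\<lambda>j. if j = i then B else {p j})" for B
    show "spherically_complete (X i) (u i) (r i)"
      unfolding spherically_complete_def
    proof (intro allI impI, elim conjE)
      fix N assume N: "N \<noteq> {}" "N \<subseteq> closed_uballs (X i) (u i) (r i)" "chain\<^sub>\<subseteq> N"
      have "lift ` N \<noteq> {}" using N(1) by simp
      moreover have "lift ` N \<subseteq>
          closed_uballs (Pi\<^sub>E J X) (u_prod J u) (prod_order J (\<lambda>j. value_set (X j) (u j)) r)"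
      proof (rule image_subsetI)
        fix B assume "B \<in> N"
        then have "\<forall>j\<in>J. (if j = i then B else {p j}) \<in> closed_uballs (X j) (u j) (r j)"
          using N(2) pt by auto
        then show "lift B \<in>
            closed_uballs (Pi\<^sub>E J X) (u_prod J u) (prod_order J (\<lambda>j. value_set (X j) (u j)) r)"
          unfolding closed_uballs_u_prod lift_def by blast
      qed
      moreover have mono: "lift B \<subseteq> lift C" if "B \<subseteq> C" for B C
        unfolding lift_def using that by (intro PiE_mono) auto
      then have "C \<subseteq> D \<or> D \<subseteq> C" if "C \<in> lift ` N" "D \<in> lift ` N" for C D
      proof (use that in \<open>elim imageE\<close>)
        fix A B assume "C = lift A" "A \<in> N" "D = lift B" "B \<in> N"
        moreover have "A \<subseteq> B \<or> B \<subseteq> A"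
          using N(3) \<open>A \<in> N\<close> \<open>B \<in> N\<close> by (simp add: chain_subset_def)
        ultimately show ?thesis using mono[of A B] mono[of B A] by auto
      qed
      ultimately have "\<Inter>(lift ` N) \<noteq> {}" by (rule spherically_completeD[OF prod])
      then obtain q where q: "\<And>C. C \<in> lift ` N \<Longrightarrow> q \<in> C" by blast
      have "q i \<in> B" if "B \<in> N" for B
        using PiE_mem[OF q[OF imageI[OF that], unfolded lift_def] i] by simp
      then show "\<Inter>N \<noteq> {}" by blast
    qed
  qed
next
  assume all: ?all
  show ?prod
    unfolding spherically_complete_def
  proof (intro allI impI, elim conjE)
    fix N
    assume N: "N \<noteq> {}" "chain\<^sub>\<subseteq> N"
      "N \<subseteq> closed_uballs (Pi\<^sub>E J X) (u_prod J u) (prod_order J (\<lambda>j. value_set (X j) (u j)) r)"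
    have "\<forall>C\<in>N. \<exists>B. C = Pi\<^sub>E J B \<and> (\<forall>j\<in>J. B j \<in> closed_uballs (X j) (u j) (r j))"
      using N(3) unfolding closed_uballs_u_prod by (simp add: subset_iff)
    from bchoice[OF this] obtain F where
        F: "\<forall>C\<in>N. C = Pi\<^sub>E J (F C) \<and> (\<forall>j\<in>J. F C j \<in> closed_uballs (X j) (u j) (r j))" ..
    show "\<Inter>N \<noteq> {}"
    proof (rule nest_of_products_Inter_nonempty[OF N(2)])
      show "C = Pi\<^sub>E J (F C)" if "C \<in> N" for C
        by (rule bspec[OF F that, THEN conjunct1])
      show "F C j \<noteq> {}" if C: "C \<in> N" and j: "j \<in> J" for C j
      proof -
        have "F C j \<in> closed_uballs (X j) (u j) (r j)"
          by (rule bspec[OF bspec[OF F C, THEN conjunct2] j])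
        then obtain \<alpha> x where "\<alpha> \<in> value_set (X j) (u j)" "x \<in> X j"
          and "F C j = uball (X j) (u j) (r j) \<alpha> x"
          by (rule closed_uball_obtain[OF um[OF j]])
        then show ?thesis using uball_center[OF um[OF j]] by blast
      qed
      show "\<Inter>((\<lambda>C. F C j) ` N) \<noteq> {}" if j: "j \<in> J"
        and nest: "\<And>A B. A \<in> (\<lambda>C. F C j) ` N \<Longrightarrow> B \<in> (\<lambda>C. F C j) ` N \<Longrightarrow> A \<subseteq> B \<or> B \<subseteq> A" for j
      proof (rule spherically_completeD[OF all[rule_format, OF j] _ _ nest])
        show "(\<lambda>C. F C j) ` N \<noteq> {}" using N(1) by simp
        show "(\<lambda>C. F C j) ` N \<subseteq> closed_uballs (X j) (u j) (r j)"
        proof (rule image_subsetI)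
          fix C assume "C \<in> N"
          then show "F C j \<in> closed_uballs (X j) (u j) (r j)"
            by (rule bspec[OF bspec[OF F, THEN conjunct2] j])
        qed
      qed
    qed
  qed
qed

section \<open>The maximum ultrametric\<close>

text \<open>To compare all factors with one another, each is given the union of the value sets as its
  set of radii. Condition (U2) for the new radii rests on totality: the larger of the two given
  distances is a radius from the old value set.\<close>

lemma ultrametric_on_enlarge_values:
  assumes um: "ultrametric_on X u W (Restr R W) z" and lin: "linear_order_on \<Gamma> R"
    and sub: "W \<subseteq> V" "V \<subseteq> \<Gamma>" and least: "\<And>\<gamma>. \<gamma> \<in> V \<Longrightarrow> (z, \<gamma>) \<in> R"
  shows "ultrametric_on X u V (Restr R V) z"
proof -
  have re: "refl_on \<Gamma> R" and tr: "trans R" and as: "antisym R" and tot: "total_on \<Gamma> R"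
    using lin unfolding order_on_defs by blast+
  have val: "u x y \<in> W" if "x \<in> X" "y \<in> X" for x y
    using um that unfolding ultrametric_on_def by blast
  have u2: "(u x w, \<gamma>) \<in> R" if X: "x \<in> X" "y \<in> X" "w \<in> X"
    and l: "(u x y, \<gamma>) \<in> R" "(u y w, \<gamma>) \<in> R" for x y w \<gamma>
  proof -
    have *: "(u x w, \<delta>) \<in> R" if "\<delta> \<in> W" "(u x y, \<delta>) \<in> R" "(u y w, \<delta>) \<in> R" for \<delta>
    proof -
      have "(u x y, \<delta>) \<in> Restr R W" "(u y w, \<delta>) \<in> Restr R W" using that val X by blast+
      then have "(u x w, \<delta>) \<in> Restr R W"
        using um X that(1) unfolding ultrametric_on_def by blast
      then show ?thesis by blast
    qed
    have v: "u x y \<in> W" "u y w \<in> W" using val X by blast+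
    then have rf: "(u x y, u x y) \<in> R" "(u y w, u y w) \<in> R"
      using refl_onD[OF re] sub by blast+
    have "(u x y, u y w) \<in> R \<or> (u y w, u x y) \<in> R"
      using tot v sub rf unfolding total_on_def by (metis subsetD)
    then show ?thesis using *[OF v(2) _ rf(2)] *[OF v(1) rf(1)] l transD[OF tr] by blast
  qed
  have "partial_order_on V (Restr R V)"
    using re tr as sub unfolding order_on_defs refl_on_def trans_def antisym_def by blast
  moreover have "X \<noteq> {}" "z \<in> V" using um sub unfolding ultrametric_on_def by blast+
  moreover have "\<forall>\<gamma>\<in>V. (z, \<gamma>) \<in> Restr R V" using least \<open>z \<in> V\<close> by blast
  moreover have "\<forall>x\<in>X. \<forall>y\<in>X. u x y \<in> V" using val sub by blast
  moreover have "\<forall>x\<in>X. \<forall>y\<in>X. u x y = z \<longleftrightarrow> x = y" "\<forall>x\<in>X. \<forall>y\<in>X. u x y = u y x"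
    using um unfolding ultrametric_on_def by blast+
  moreover have "\<forall>x\<in>X. \<forall>y\<in>X. \<forall>w\<in>X. \<forall>\<gamma>\<in>V.
      (u x y, \<gamma>) \<in> Restr R V \<longrightarrow> (u y w, \<gamma>) \<in> Restr R V \<longrightarrow> (u x w, \<gamma>) \<in> Restr R V"
    using u2 val sub by blast
  ultimately show ?thesis unfolding ultrametric_on_def by blast
qed

text \<open>A maximum is bounded by \<open>\<alpha>\<close> if and only if every entry is. In contrast to the product
  ultrametric, all coordinates share the radius \<open>\<alpha>\<close>.\<close>

lemma uball_u_max:
  assumes fin: "finite J" and "J \<noteq> {}" and lin: "linear_order_on \<Gamma> R"
    and V: "V \<subseteq> \<Gamma>" and val: "\<And>j. j \<in> J \<Longrightarrow> value_set (X j) (u j) \<subseteq> V"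
    and x: "x \<in> Pi\<^sub>E J X"
  shows "uball (Pi\<^sub>E J X) (u_max R J u) (Restr R V) \<alpha> x
    = Pi\<^sub>E J (\<lambda>j. uball (X j) (u j) (Restr R V) \<alpha> (x j))"
proof -
  have tr: "trans R" using lin unfolding order_on_defs by blast
  have "(u_max R J u x y, \<alpha>) \<in> Restr R V \<longleftrightarrow> (\<forall>j\<in>J. (u j (x j) (y j), \<alpha>) \<in> Restr R V)"
    if y: "y \<in> Pi\<^sub>E J X" for y
  proof -
    have S: "(\<lambda>j. u j (x j) (y j)) ` J \<subseteq> V"
      using val PiE_mem[OF x] PiE_mem[OF y] unfolding value_set_def by blast
    then have m: "u_max R J u x y \<in> (\<lambda>j. u j (x j) (y j)) ` J"
      "\<And>j. j \<in> J \<Longrightarrow> (u j (x j) (y j), u_max R J u x y) \<in> R"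
      using max_wrt[OF lin, of "(\<lambda>j. u j (x j) (y j)) ` J"] fin \<open>J \<noteq> {}\<close> V
      unfolding u_max_def by auto
    show ?thesis
    proof
      assume "(u_max R J u x y, \<alpha>) \<in> Restr R V"
      then show "\<forall>j\<in>J. (u j (x j) (y j), \<alpha>) \<in> Restr R V" using transD[OF tr m(2)] S by blast
    next
      assume "\<forall>j\<in>J. (u j (x j) (y j), \<alpha>) \<in> Restr R V"
      then show "(u_max R J u x y, \<alpha>) \<in> Restr R V" using m(1) by auto
    qed
  qed
  then have "uball (Pi\<^sub>E J X) (u_max R J u) (Restr R V) \<alpha> x
      = {y \<in> Pi\<^sub>E J X. \<forall>j\<in>J. (u j (x j) (y j), \<alpha>) \<in> Restr R V}"
    unfolding uball_def by (intro Collect_cong conj_cong refl)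
  also have "\<dots> = Pi\<^sub>E J (\<lambda>j. uball (X j) (u j) (Restr R V) \<alpha> (x j))"
    by (simp add: set_eq_iff uball_def PiE_iff ball_conj_distrib conj_ac)
  finally show ?thesis .
qed

lemma spherically_complete_u_max_iff:
  assumes fin: "finite J" and "J \<noteq> {}" and lin: "linear_order_on \<Gamma> R"
    and um: "\<And>j. j \<in> J \<Longrightarrow> ultrametric_on (X j) (u j) (value_set (X j) (u j)) (r j) c"
    and sub: "\<And>j. j \<in> J \<Longrightarrow> value_set (X j) (u j) \<subseteq> \<Gamma>"
    and r: "\<And>j. j \<in> J \<Longrightarrow> r j = Restr R (value_set (X j) (u j))"
  shows "spherically_complete (Pi\<^sub>E J X) (u_max R J u) (Restr R (\<Union>j\<in>J. value_set (X j) (u j)))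
    \<longleftrightarrow> (\<forall>j\<in>J. spherically_complete (X j) (u j) (r j))"
proof -
  define V where "V = (\<Union>j\<in>J. value_set (X j) (u j))"
  define s where "s = Restr R V"
  have V: "V \<subseteq> \<Gamma>" and vV: "\<And>j. j \<in> J \<Longrightarrow> value_set (X j) (u j) \<subseteq> V"
    using sub unfolding V_def by blast+
  have tot: "total_on V s"
    using lin V unfolding order_on_defs total_on_def s_def by blast
  have least: "(c, \<gamma>) \<in> R" if "\<gamma> \<in> V" for \<gamma>
  proof -
    from that obtain j where "j \<in> J" "\<gamma> \<in> value_set (X j) (u j)" unfolding V_def by blast
    then show ?thesis using um[of j] r[of j] unfolding ultrametric_on_def by blast
  qed
  have umV: "ultrametric_on (X j) (u j) V s c" if j: "j \<in> J" for j
    unfolding s_def using ultrametric_on_enlarge_values[OF _ lin vV[OF j] V least] um[OF j] r[OF j]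
    by simp
  have umax: "ultrametric_on (Pi\<^sub>E J X) (u_max R J u) V s c"
    unfolding s_def V_def
    by (rule ultrametric_on_u_max[OF fin \<open>J \<noteq> {}\<close> lin]) (rule um sub r; assumption)+
  have vals: "value_set (Pi\<^sub>E J X) (u_max R J u) = V"
    unfolding V_def
    by (rule value_set_u_max[OF fin \<open>J \<noteq> {}\<close> lin]) (rule um sub r; assumption)+
  have ball: "uball (Pi\<^sub>E J X) (u_max R J u) s \<alpha> x = Pi\<^sub>E J (\<lambda>j. uball (X j) (u j) s \<alpha> (x j))"
    if "x \<in> Pi\<^sub>E J X" for \<alpha> x
    unfolding s_def using uball_u_max[OF fin \<open>J \<noteq> {}\<close> lin V vV that] .
  have sc_eq: "spherically_complete (X j) (u j) (r j) \<longleftrightarrow> spherically_complete (X j) (u j) s"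
    if "j \<in> J" for j
    using spherically_complete_Restr[OF vV[OF that], of R]
      spherically_complete_Restr[OF order_refl, of "X j" "u j" R] r[OF that] by (simp add: s_def)
  have "spherically_complete (Pi\<^sub>E J X) (u_max R J u) s
      \<longleftrightarrow> (\<forall>j\<in>J. spherically_complete (X j) (u j) s)" (is "?max' \<longleftrightarrow> ?all'")
  proof
    assume max: ?max'
    show ?all'
    proof
      fix i assume i: "i \<in> J"
      obtain p where p: "p \<in> Pi\<^sub>E J X" using umax unfolding ultrametric_on_def by blast
      have upd: "p(i := w) \<in> Pi\<^sub>E J X" if "w \<in> X i" for w
        using p that i by (auto simp: PiE_iff extensional_def)
      have in_ball: "p(i := w) \<in> uball (Pi\<^sub>E J X) (u_max R J u) s \<alpha> (p(i := x))"
        if "\<alpha> \<in> V" "x \<in> X i" "w \<in> uball (X i) (u i) s \<alpha> x" for \<alpha> x w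
        unfolding ball[OF upd[OF that(2)]]
        using upd[of w] that uball_center[OF umV PiE_mem[OF p]] by (auto simp: PiE_iff uball_def)
      show "spherically_complete (X i) (u i) s"
        unfolding spherically_complete_def
      proof (intro allI impI, elim conjE)
        fix N assume N: "N \<noteq> {}" "N \<subseteq> closed_uballs (X i) (u i) s" "chain\<^sub>\<subseteq> N"
        \<comment> \<open>One set can be a ball for several radii, and these may have different lifts. Taking all of
          them avoids a choice; since the lifts pairwise meet, they still form a nest.\<close>
        define L where "L = {uball (Pi\<^sub>E J X) (u_max R J u) s \<alpha> (p(i := x)) |\<alpha> x.
          \<alpha> \<in> V \<and> x \<in> X i \<and> uball (X i) (u i) s \<alpha> x \<in> N}"
        have N_ball: "\<exists>\<alpha> x. \<alpha> \<in> V \<and> x \<in> X i \<and> B = uball (X i) (u i) s \<alpha> x" if "B \<in> N" for B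
          using that N(2) vV[OF i] unfolding closed_uballs_def by blast
        then have "L \<noteq> {}" using N(1) unfolding L_def by blast
        moreover have "L \<subseteq> closed_uballs (Pi\<^sub>E J X) (u_max R J u) s"
          using upd unfolding L_def closed_uballs_def vals by blast
        moreover have "C \<subseteq> D \<or> D \<subseteq> C" if CD: "C \<in> L" "D \<in> L" for C D
        proof -
          obtain \<alpha> x where x: "\<alpha> \<in> V" "x \<in> X i" "uball (X i) (u i) s \<alpha> x \<in> N"
            and C: "C = uball (Pi\<^sub>E J X) (u_max R J u) s \<alpha> (p(i := x))"
            using CD(1) unfolding L_def by blast
          obtain \<beta> y where y: "\<beta> \<in> V" "y \<in> X i" "uball (X i) (u i) s \<beta> y \<in> N"
            and D: "D = uball (Pi\<^sub>E J X) (u_max R J u) s \<beta> (p(i := y))"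
            using CD(2) unfolding L_def by blast
          have "uball (X i) (u i) s \<alpha> x \<subseteq> uball (X i) (u i) s \<beta> y
              \<or> uball (X i) (u i) s \<beta> y \<subseteq> uball (X i) (u i) s \<alpha> x"
            using x(3) y(3) N(3) unfolding chain_subset_def by blast
          then obtain w where "w \<in> uball (X i) (u i) s \<alpha> x" "w \<in> uball (X i) (u i) s \<beta> y"
            using uball_center[OF umV[OF i] x(2,1)] uball_center[OF umV[OF i] y(2,1)] by blast
          then have "C \<inter> D \<noteq> {}" using in_ball x y unfolding C D by blast
          then show ?thesis
            unfolding C D using uballs_meet_comparable[OF umax tot upd x(1) upd y(1)] x(2) y(2)
            by blast
        qed
        ultimately have "\<Inter>L \<noteq> {}" by (rule spherically_completeD[OF max])
        then obtain q where q: "\<And>C. C \<in> L \<Longrightarrow> q \<in> C" by blast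
        have "q i \<in> B" if B: "B \<in> N" for B
        proof -
          obtain \<alpha> x where x: "\<alpha> \<in> V" "x \<in> X i" "B = uball (X i) (u i) s \<alpha> x"
            using N_ball[OF B] by blast
          then have "q \<in> uball (Pi\<^sub>E J X) (u_max R J u) s \<alpha> (p(i := x))"
            using B by (intro q) (auto simp: L_def)
          then show ?thesis unfolding ball[OF upd[OF x(2)]] using i x(3) by (auto dest: PiE_mem)
        qed
        then show "\<Inter>N \<noteq> {}" by blast
      qed
    qed
  next
    assume all: ?all'
    show ?max'
      unfolding spherically_complete_def
    proof (intro allI impI, elim conjE)
      fix N
      assume N: "N \<noteq> {}" "N \<subseteq> closed_uballs (Pi\<^sub>E J X) (u_max R J u) s" "chain\<^sub>\<subseteq> N"
      have "\<forall>C\<in>N. \<exists>ax. fst ax \<in> V \<and> snd ax \<in> Pi\<^sub>E J X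
          \<and> C = uball (Pi\<^sub>E J X) (u_max R J u) s (fst ax) (snd ax)"
        using N(2) unfolding closed_uballs_def vals by fastforce
      from bchoice[OF this] obtain ax
        where AX: "\<forall>C\<in>N. fst (ax C) \<in> V \<and> snd (ax C) \<in> Pi\<^sub>E J X
          \<and> C = uball (Pi\<^sub>E J X) (u_max R J u) s (fst (ax C)) (snd (ax C))" ..
      note ax = bspec[OF AX, THEN conjunct1] bspec[OF AX, THEN conjunct2, THEN conjunct1]
        bspec[OF AX, THEN conjunct2, THEN conjunct2]
      define F where "F C j = uball (X j) (u j) s (fst (ax C)) (snd (ax C) j)" for C j
      show "\<Inter>N \<noteq> {}"
      proof (rule nest_of_products_Inter_nonempty[OF N(3)])
        show "C = Pi\<^sub>E J (F C)" if "C \<in> N" for C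
          unfolding F_def ball[OF ax(2)[OF that], symmetric] by (rule ax(3)[OF that])
        show "F C j \<noteq> {}" if "C \<in> N" "j \<in> J" for C j
          using uball_center[OF umV[OF that(2)] PiE_mem[OF ax(2)[OF that(1)] that(2)] ax(1)[OF that(1)]]
          unfolding F_def by blast
        show "\<Inter>((\<lambda>C. F C j) ` N) \<noteq> {}" if j: "j \<in> J"
          and nest: "\<And>A B. A \<in> (\<lambda>C. F C j) ` N \<Longrightarrow> B \<in> (\<lambda>C. F C j) ` N \<Longrightarrow> A \<subseteq> B \<or> B \<subseteq> A" for j
        proof (rule nest_of_uballs_Inter_nonempty[OF umV[OF j] tot all[rule_format, OF j] _ _ nest])
          show "(\<lambda>C. F C j) ` N \<noteq> {}" using N(1) by simp
          show "\<exists>\<alpha>\<in>V. \<exists>x\<in>X j. B = uball (X j) (u j) s \<alpha> x" if "B \<in> (\<lambda>C. F C j) ` N" for B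
            using that ax(1) PiE_mem[OF ax(2) j] unfolding F_def by blast
        qed
      qed
    qed
  qed
  then show ?thesis using sc_eq by (simp add: s_def V_def)
qed

theorem theorem8p6:
  fixes J :: "'j set" and X :: "'j \<Rightarrow> 'a set" and u :: "'j \<Rightarrow> 'a \<Rightarrow> 'a \<Rightarrow> 'g"
    and r :: "'j \<Rightarrow> 'g rel" and z :: "'j \<Rightarrow> 'g"
  assumes "J \<noteq> {}"
    and "\<And>j. j \<in> J \<Longrightarrow> ultrametric_on (X j) (u j) (value_set (X j) (u j)) (r j) (z j)"
  shows
    "(spherically_complete (Pi\<^sub>E J X) (u_prod J u)
        (prod_order J (\<lambda>j. value_set (X j) (u j)) r)
      \<longleftrightarrow> (\<forall>j\<in>J. spherically_complete (X j) (u j) (r j)))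
     \<and>
     (\<forall>\<Gamma> R c.
        finite J \<and> linear_order_on \<Gamma> R \<and>
        (\<forall>j\<in>J. value_set (X j) (u j) \<subseteq> \<Gamma> \<and> r j = Restr R (value_set (X j) (u j)) \<and> z j = c)
        \<longrightarrow>
        (spherically_complete (Pi\<^sub>E J X) (u_max R J u) (Restr R (\<Union>j\<in>J. value_set (X j) (u j)))
         \<longleftrightarrow> (\<forall>j\<in>J. spherically_complete (X j) (u j) (r j))))"
proof (intro conjI allI impI)
  show "spherically_complete (Pi\<^sub>E J X) (u_prod J u) (prod_order J (\<lambda>j. value_set (X j) (u j)) r)
      \<longleftrightarrow> (\<forall>j\<in>J. spherically_complete (X j) (u j) (r j))"
    by (rule spherically_complete_u_prod_iff[OF assms(2)])
next
  fix \<Gamma> R c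
  assume H: "finite J \<and> linear_order_on \<Gamma> R \<and>
    (\<forall>j\<in>J. value_set (X j) (u j) \<subseteq> \<Gamma> \<and> r j = Restr R (value_set (X j) (u j)) \<and> z j = c)"
  show "spherically_complete (Pi\<^sub>E J X) (u_max R J u) (Restr R (\<Union>j\<in>J. value_set (X j) (u j)))
      \<longleftrightarrow> (\<forall>j\<in>J. spherically_complete (X j) (u j) (r j))"
  proof (rule spherically_complete_u_max_iff)
    show "ultrametric_on (X j) (u j) (value_set (X j) (u j)) (r j) c" if "j \<in> J" for j
      using assms(2)[OF that] H that by simp
  qed (use H assms(1) in blast)+
qed

end
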